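(* Let $T>0$, let $H\in\mathbb{C}^{M\times M}$ be Hermitian, let $\Psi_0\in\mathbb{C}^M$ and $\Psi(t)=e^{-itH}\Psi_0$. Let $V\in\mathbb{C}^{M\times m}$ be a fixed matrix of full column rank, $S=V^\dagger V$, $P_V=VS^{-1}V^\dagger$, and let $\Psi_m:[0,T]\to\mathbb{C}^M$ solve $$i\dot\Psi_m=P_VH\Psi_m,\qquad \Psi_m(0)=P_V\Psi_0 .$$ Define $$\eta_V(t)=\lVert(I-P_V)H\Psi_m(t)\rVert_2,\qquad \delta_V(t)=\lVert(I-P_V)\Psi_0\rVert_2+\int_0^t\eta_V(s)\,ds .$$ Then for $0\le t\le T$, $$\lVert\Psi(t)-\Psi_m(t)\rVert_2\le\delta_V(t).$$ Consequently, suppose $\Psi_0=Ju_{0,h}$ where $(H,J,R)$ is a lift--recovery realization on $[0,T]$, with error $\varepsilon_{\mathrm{lift}}$, of the semidiscrete system $\dot u_h=A_hu_h$, $u_h(0)=u_{0,h}\in\mathbb{C}^{N_h}$. Then for $0\le t\le T$, $$\lVert u_h(t)-R\Psi_m(t)\rVert_2\le\varepsilon_{\mathrm{lift}}(t)+\lVert R\rVert_2\,\delta_V(t).$$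
   Context: $\lVert\cdot\rVert_2$ denotes the Euclidean vector norm and the induced spectral matrix norm; $\dagger$ is the conjugate transpose. $P_V$ is the orthogonal projector onto the range of $V$. Lift--recovery realization: given $A_h\in\mathbb{C}^{N_h\times N_h}$, $u_{0,h}\in\mathbb{C}^{N_h}$ and the solution $u_h$ of $\dot u_h=A_hu_h$, $u_h(0)=u_{0,h}$, a lift--recovery realization on $[0,T]$ with error $\varepsilon_{\mathrm{lift}}:[0,T]\to[0,\infty)$ consists of a Hermitian matrix $H\in\mathbb{C}^{M\times M}$, a linear injection $J:\mathbb{C}^{N_h}\to\mathbb{C}^M$ and a linear recovery map $R:\mathbb{C}^M\to\mathbb{C}^{N_h}$ such that $$\lVert u_h(t)-R\,e^{-itH}Ju_{0,h}\rVert_2\le\varepsilon_{\mathrm{lift}}(t)\qquad\text{for all }0\le t\le T .$$ (All these objects may depend on a mesh parameter $h$, an auxiliary resolution parameter $q$, and a parameter vector $\mu$, which are held fixed.) *)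

theory Defs
  imports "HOL-Analysis.Analysis"
begin

definition ctranspose :: "complex ^ 'n ^ 'm \<Rightarrow> complex ^ 'm ^ 'n"
  where "ctranspose A = (\<chi> i j. cnj (A $ j $ i))"

definition hermitian :: "complex ^ 'n ^ 'n \<Rightarrow> bool"
  where "hermitian A \<longleftrightarrow> ctranspose A = A"

definition mat_cscale :: "complex \<Rightarrow> complex ^ 'n ^ 'm \<Rightarrow> complex ^ 'n ^ 'm"
  where "mat_cscale c A = (\<chi> i j. c * A $ i $ j)"

primrec mat_pow :: "complex ^ 'n ^ 'n \<Rightarrow> nat \<Rightarrow> complex ^ 'n ^ 'n"
  where
    "mat_pow A 0 = mat 1"
  | "mat_pow A (Suc k) = A ** mat_pow A k"

text \<open>
  The library's \<open>exp\<close> is not available for the type of square matrices (which is not a normed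
  algebra under \<open>**\<close>). The series below converges for every matrix, in the entrywise topology.
\<close>

definition mat_exp :: "complex ^ 'n ^ 'n \<Rightarrow> complex ^ 'n ^ 'n"
  where "mat_exp A = (\<Sum>k. (1 / fact k) *\<^sub>R mat_pow A k)"

definition schrodinger_evol :: "complex ^ 'n ^ 'n \<Rightarrow> real \<Rightarrow> complex ^ 'n \<Rightarrow> complex ^ 'n"
  where "schrodinger_evol H t \<psi> = mat_exp (mat_cscale (- \<i> * complex_of_real t) H) *v \<psi>"

definition full_column_rank :: "complex ^ 'm ^ 'n \<Rightarrow> bool"
  where "full_column_rank V \<longleftrightarrow> rank V = CARD('m)"

text \<open>
  Meaningful for \<open>V\<close> of full column rank only: then the Gram matrix is invertible and this is
  the orthogonal projector onto the range of \<open>V\<close>.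
\<close>

definition range_proj :: "complex ^ 'm ^ 'n \<Rightarrow> complex ^ 'n ^ 'n"
  where "range_proj V = V ** matrix_inv (ctranspose V ** V) ** ctranspose V"

definition solves_linear_ivp ::
  "real \<Rightarrow> complex ^ 'n ^ 'n \<Rightarrow> complex ^ 'n \<Rightarrow> (real \<Rightarrow> complex ^ 'n) \<Rightarrow> bool"
  where "solves_linear_ivp T A u0 u \<longleftrightarrow>
    u 0 = u0 \<and> (\<forall>t\<in>{0..T}. (u has_vector_derivative A *v u t) (at t within {0..T}))"

definition solves_reduced_ivp ::
  "real \<Rightarrow> complex ^ 'n ^ 'n \<Rightarrow> complex ^ 'm ^ 'n \<Rightarrow> complex ^ 'n \<Rightarrow> (real \<Rightarrow> complex ^ 'n) \<Rightarrow> bool"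
  where "solves_reduced_ivp T H V \<Psi>0 \<Psi>m \<longleftrightarrow>
    \<Psi>m 0 = range_proj V *v \<Psi>0 \<and>
    (\<forall>t\<in>{0..T}. \<exists>D. (\<Psi>m has_vector_derivative D) (at t within {0..T}) \<and>
      \<i> *s D = (range_proj V ** H) *v \<Psi>m t)"

definition residual ::
  "complex ^ 'n ^ 'n \<Rightarrow> complex ^ 'm ^ 'n \<Rightarrow> (real \<Rightarrow> complex ^ 'n) \<Rightarrow> real \<Rightarrow> real"
  where "residual H V \<Psi>m t = norm (((mat 1 - range_proj V) ** H) *v \<Psi>m t)"

definition reduction_bound ::
  "complex ^ 'n ^ 'n \<Rightarrow> complex ^ 'm ^ 'n \<Rightarrow> complex ^ 'n \<Rightarrow> (real \<Rightarrow> complex ^ 'n) \<Rightarrow> real \<Rightarrow> real"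
  where "reduction_bound H V \<Psi>0 \<Psi>m t =
    norm ((mat 1 - range_proj V) *v \<Psi>0) + integral {0..t} (residual H V \<Psi>m)"

text \<open>
  Linearity of the lift \<open>J\<close> and the recovery \<open>R\<close> is over the complex numbers (the library's
  \<open>linear\<close> would only be real linearity). The condition refers to a solution \<open>u\<close> of the
  semidiscrete system, which is unique on the interval.
\<close>

definition lift_recovery_realization ::
  "real \<Rightarrow> complex ^ 'k ^ 'k \<Rightarrow> complex ^ 'k \<Rightarrow> (real \<Rightarrow> complex ^ 'k) \<Rightarrow> (real \<Rightarrow> real) \<Rightarrow>
   complex ^ 'n ^ 'n \<Rightarrow> (complex ^ 'k \<Rightarrow> complex ^ 'n) \<Rightarrow> (complex ^ 'n \<Rightarrow> complex ^ 'k) \<Rightarrow> bool"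
  where "lift_recovery_realization T A u0 u \<epsilon> H J R \<longleftrightarrow>
    solves_linear_ivp T A u0 u \<and>
    hermitian H \<and>
    Vector_Spaces.linear (*s) (*s) J \<and> inj J \<and>
    Vector_Spaces.linear (*s) (*s) R \<and>
    (\<forall>t\<in>{0..T}. 0 \<le> \<epsilon> t) \<and>
    (\<forall>t\<in>{0..T}. norm (u t - R (schrodinger_evol H t (J u0))) \<le> \<epsilon> t)"

end

theory Submission
  imports Defs
begin

text \<open>
  The error \<open>e = \<Psi> - \<Psi>m\<close> satisfies \<open>e' = - i H e - i r\<close> with the residual
  \<open>r = (I - P) H \<Psi>m\<close>. Since \<open>H\<close> is Hermitian, the first term is orthogonal to \<open>e\<close> in the real
  inner product, so \<open>(|e|\<^sup>2)' / 2 \<le> |r| |e|\<close>, and integration gives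
  \<open>|e(t)| \<le> |e(0)| + \<integral> |r|\<close>. Linearity of the recovery map turns this into the second estimate.
\<close>

text \<open>Here \<open>\<bullet>\<close> is the real part of the Hermitian product, so moving an
  entry of \<open>A\<close> to the other factor conjugates it.\<close>

lemma inner_mat_adjoint: "(A *v x) \<bullet> y = x \<bullet> (ctranspose A *v y)"
  for A :: "complex ^ 'n ^ 'm"
proof -
  have "(A *v x) \<bullet> y = (\<Sum>i\<in>UNIV. \<Sum>j\<in>UNIV. (A $ i $ j * x $ j) \<bullet> (y $ i))"
    by (simp add: inner_vec_def matrix_vector_mult_def inner_sum_left)
  also have "\<dots> = (\<Sum>j\<in>UNIV. \<Sum>i\<in>UNIV. (A $ i $ j * x $ j) \<bullet> (y $ i))"
    by (rule sum.swap)
  also have "\<dots> = (\<Sum>j\<in>UNIV. \<Sum>i\<in>UNIV. (x $ j) \<bullet> (cnj (A $ i $ j) * y $ i))"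
    by (intro sum.cong refl) (simp add: inner_complex_def algebra_simps)
  also have "\<dots> = x \<bullet> (ctranspose A *v y)"
    by (simp add: inner_vec_def matrix_vector_mult_def inner_sum_right ctranspose_def)
  finally show ?thesis .
qed

lemma inner_i_left: "(\<i> *s x) \<bullet> y = - (x \<bullet> (\<i> *s y))"
  for x y :: "complex ^ 'n"
  by (simp add: inner_vec_def inner_complex_def flip: sum_negf)

lemma norm_i_scale: "norm (\<i> *s x) = norm x" for x :: "complex ^ 'n"
  by (simp add: norm_vec_def norm_mult)

text \<open>Moving \<open>\<i>\<close> across the product changes the sign and moving
  \<open>H\<close> does not, so this real number equals its own negative. It is the infinitesimal
  form of norm conservation.\<close>

lemma hermitian_i_inner_eq_0:
  assumes "hermitian H"
  shows "v \<bullet> (\<i> *s (H *v v)) = 0"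
proof -
  have "(\<i> *s (H *v v)) \<bullet> v = - ((H *v v) \<bullet> (\<i> *s v))"
    by (rule inner_i_left)
  also have "\<dots> = - (v \<bullet> (H *v (\<i> *s v)))"
    using assms by (simp add: inner_mat_adjoint hermitian_def)
  also have "\<dots> = - (v \<bullet> (\<i> *s (H *v v)))"
    by (simp add: vector_scalar_commute)
  finally show ?thesis by (simp add: inner_commute)
qed

text \<open>Formally, \<open>norm (e s)\<close> has derivative
  \<open>(e s \<bullet> e' s) / norm (e s)\<close>, which is at most \<open>\<eta> s\<close>.
  Bounding the inner product instead of \<open>norm (e' s)\<close> lets any part of
  \<open>e'\<close> orthogonal to \<open>e\<close> drop out, so no exponential growth factor
  appears.\<close>

lemma norm_le_of_inner_derivative_le:
  fixes e :: "real \<Rightarrow> 'a::real_inner"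
  assumes "0 \<le> t"
    and e: "\<And>s. s \<in> {0..t} \<Longrightarrow> (e has_vector_derivative e' s) (at s within {0..t})"
    and le: "\<And>s. s \<in> {0..t} \<Longrightarrow> e s \<bullet> e' s \<le> \<eta> s * norm (e s)"
    and nonneg: "\<And>s. s \<in> {0..t} \<Longrightarrow> 0 \<le> \<eta> s"
    and int: "\<eta> integrable_on {0..t}"
  shows "norm (e t) \<le> norm (e 0) + integral {0..t} \<eta>"
proof (rule field_le_epsilon)
  fix d :: real assume "0 < d"
  \<comment> \<open>The norm need not be differentiable where \<open>e\<close> vanishes, so it is regularised by \<open>d\<close>.\<close>
  define f where "f s = sqrt (e s \<bullet> e s + d\<^sup>2)" for s
  have pos: "e s \<bullet> e s + d\<^sup>2 > 0" for s
    using \<open>0 < d\<close> by (simp add: add_nonneg_pos)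
  have norm_f: "norm (e s) \<le> f s" for s
    by (simp add: f_def norm_eq_sqrt_inner)
  have f': "(f has_vector_derivative (e s \<bullet> e' s) / f s) (at s within {0..t})"
    if "s \<in> {0..t}" for s
    using e[OF that] pos[of s]
    unfolding f_def has_vector_derivative_def has_real_derivative_iff_has_vector_derivative[symmetric]
      has_field_derivative_def
    by (auto intro!: derivative_eq_intros ext simp: inner_commute field_simps)
  have "((\<lambda>s. (e s \<bullet> e' s) / f s) has_integral f t - f 0) {0..t}"
    using \<open>0 \<le> t\<close> f' by (rule fundamental_theorem_of_calculus)
  moreover have "(e s \<bullet> e' s) / f s \<le> \<eta> s" if "s \<in> {0..t}" for s
  proof -
    have "e s \<bullet> e' s \<le> \<eta> s * f s"
      using le[OF that] mult_left_mono[OF norm_f nonneg[OF that]] by (rule order_trans)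
    moreover have "f s > 0" using pos by (simp add: f_def)
    ultimately show ?thesis by (simp add: field_simps)
  qed
  ultimately have "f t - f 0 \<le> integral {0..t} \<eta>"
    using has_integral_le[OF _ integrable_integral[OF int]] by blast
  \<comment> \<open>Subadditivity of the square root: the regularisation costs at most
    \<open>d\<close>, exactly the slack granted.\<close>
  moreover have "f 0 \<le> norm (e 0) + d"
    using \<open>0 < d\<close> sqrt_add_le_add_sqrt[of "e 0 \<bullet> e 0" "d\<^sup>2"]
    by (simp add: f_def norm_eq_sqrt_inner)
  ultimately show "norm (e t) \<le> norm (e 0) + integral {0..t} \<eta> + d"
    using norm_f[of t] by simp
qed

lemma mat_pow_cscale: "mat_pow (mat_cscale z A) k = mat_cscale (z ^ k) (mat_pow A k)"
  by (induction k)
    (simp_all add: mat_cscale_def matrix_matrix_mult_def vec_eq_iff mat_def sum_distrib_left mult_ac)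

text \<open>Supplies submultiplicativity of the matrix norm up to a constant, which is enough for
  convergence of the exponential series.\<close>

lemma bounded_bilinear_matrix_matrix_mult_complex:
  "bounded_bilinear ((**) :: complex ^ 'n ^ 'm \<Rightarrow> complex ^ 'p ^ 'n \<Rightarrow> complex ^ 'p ^ 'm)"
  unfolding bilinear_conv_bounded_bilinear[symmetric] bilinear_def
  by (auto intro!: linearI simp: matrix_matrix_mult_def vec_eq_iff sum.distrib scaleR_sum_right
      algebra_simps)

text \<open>Comparison with the real exponential series at \<open>norm A * K\<close>, where
  \<open>K\<close> is the constant of the product estimate.\<close>

lemma summable_mat_exp: "summable (\<lambda>k. (1 / fact k) *\<^sub>R mat_pow A k)"
proof -
  obtain K where K: "K > 0" "\<And>B C. norm ((B :: complex ^ 'a ^ 'a) ** (C :: complex ^ 'a ^ 'a)) \<le> norm B * norm C * K"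
    using bounded_bilinear.pos_bounded[OF bounded_bilinear_matrix_matrix_mult_complex] by blast
  let ?c = "norm (mat 1 :: complex ^ 'a ^ 'a)"
  have bound: "norm (mat_pow A k) \<le> ?c * (norm A * K) ^ k" for k
  proof (induction k)
    case (Suc k)
    have "norm (mat_pow A (Suc k)) \<le> norm A * norm (mat_pow A k) * K"
      using K(2) by simp
    also have "\<dots> \<le> norm A * (?c * (norm A * K) ^ k) * K"
      using Suc K(1) by (intro mult_right_mono mult_left_mono) auto
    finally show ?case by (simp add: mult_ac)
  qed simp
  show ?thesis
  proof (rule summable_comparison_test')
    show "summable (\<lambda>k. ?c * (inverse (fact k) * (norm A * K) ^ k))"
      by (intro summable_mult summable_exp)
    show "norm ((1 / fact k) *\<^sub>R mat_pow A k) \<le> ?c * (inverse (fact k) * (norm A * K) ^ k)" for k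
      using bound[of k] by (simp add: field_simps)
  qed
qed

text \<open>With the vector and the index fixed, the exponential becomes a scalar power series in
  \<open>z\<close>, to which termwise differentiation applies.\<close>

lemma mat_exp_component_sums:
  fixes A :: "complex ^ 'n ^ 'n"
  shows "(\<lambda>k. (mat_pow A k *v x) $ i / fact k * z ^ k) sums ((mat_exp (mat_cscale z A) *v x) $ i)"
proof -
  \<comment> \<open>Applying a matrix to \<open>x\<close> and taking a component is continuous,
    hence commutes with the infinite sum.\<close>
  have lin: "bounded_linear (\<lambda>B :: complex ^ 'n ^ 'n. (B *v x) $ i)"
    by (intro linear_conv_bounded_linear[THEN iffD1] linearI)
      (simp_all add: matrix_vector_mult_def sum.distrib scaleR_sum_right algebra_simps)
  have "(\<lambda>k. (((1 / fact k) *\<^sub>R mat_pow (mat_cscale z A) k) *v x) $ i)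
      sums ((mat_exp (mat_cscale z A) *v x) $ i)"
    unfolding mat_exp_def by (intro bounded_linear.sums[OF lin] summable_sums summable_mat_exp)
  moreover have "(((1 / fact k) *\<^sub>R mat_pow (mat_cscale z A) k) *v x) $ i
      = (mat_pow A k *v x) $ i / fact k * z ^ k" for k
    unfolding mat_pow_cscale
    by (simp add: mat_cscale_def matrix_vector_mult_def scaleR_conv_of_real[where 'a = complex]
        sum_divide_distrib sum_distrib_left mult_ac)
  ultimately show ?thesis by simp
qed

lemma mat_exp_component_derivative:
  fixes A :: "complex ^ 'n ^ 'n"
  shows "((\<lambda>z. (mat_exp (mat_cscale z A) *v x) $ i) has_field_derivative
    (A *v (mat_exp (mat_cscale z A) *v x)) $ i) (at z)"
proof -
  let ?c = "\<lambda>k. (mat_pow A k *v x) $ i / fact k"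
  have eq: "(\<Sum>k. ?c k * w ^ k) = (mat_exp (mat_cscale w A) *v x) $ i" for w
    using mat_exp_component_sums by (rule sums_unique[symmetric])
  have "((\<lambda>w. \<Sum>k. ?c k * w ^ k) has_field_derivative (\<Sum>k. diffs ?c k * z ^ k)) (at z)"
    by (rule termdiffs_strong_converges_everywhere) (rule sums_summable[OF mat_exp_component_sums])
  moreover have "(\<lambda>k. \<Sum>j\<in>UNIV. A $ i $ j * ((mat_pow A k *v x) $ j / fact k * z ^ k))
      sums ((A *v (mat_exp (mat_cscale z A) *v x)) $ i)"
    unfolding matrix_vector_mult_def[of A] vec_lambda_beta
    by (intro sums_sum sums_mult mat_exp_component_sums)
  moreover have "(\<Sum>j\<in>UNIV. A $ i $ j * ((mat_pow A k *v x) $ j / fact k * z ^ k))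
      = diffs ?c k * z ^ k" for k
  proof -
    have "(\<Sum>j\<in>UNIV. A $ i $ j * ((mat_pow A k *v x) $ j / fact k * z ^ k))
      = (A *v (mat_pow A k *v x)) $ i / fact k * z ^ k"
      by (simp add: matrix_vector_mult_def[of A] sum_divide_distrib sum_distrib_left mult_ac)
    also have "\<dots> = (mat_pow A (Suc k) *v x) $ i / fact k * z ^ k"
      by (simp add: matrix_vector_mul_assoc)
    \<comment> \<open>The factor \<open>Suc k\<close> from differentiation cancels against
      \<open>fact (Suc k)\<close>; keeping it and the power folded lets the simplifier see
      this.\<close>
    also have "\<dots> = diffs ?c k * z ^ k"
      by (simp add: diffs_def del: mat_pow.simps of_nat_Suc)
    finally show ?thesis .
  qed
  ultimately show ?thesis
    unfolding eq by (simp only: sums_iff)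
qed

lemma has_vector_derivative_vec_nth:
  fixes f :: "real \<Rightarrow> 'a::real_normed_vector ^ 'n"
  assumes "\<And>i. ((\<lambda>t. f t $ i) has_vector_derivative f' $ i) (at t within S)"
  shows "(f has_vector_derivative f') (at t within S)"
  using assms
  unfolding has_vector_derivative_def has_derivative_within
  by (auto intro!: vec_tendstoI bounded_linear_scaleR_left)

text \<open>Chain rule in each component: the complex derivative in \<open>z\<close> is taken along
  the path \<open>- \<i> * t\<close>.\<close>

lemma schrodinger_evol_has_vector_derivative:
  "((\<lambda>t. schrodinger_evol H t \<psi>) has_vector_derivative - (\<i> *s (H *v schrodinger_evol H t \<psi>)))
    (at t within S)"
proof (rule has_vector_derivative_vec_nth)
  fix i
  have "((\<lambda>t. - \<i> * complex_of_real t) has_vector_derivative - \<i>) (at t within S)"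
    by (auto intro!: derivative_eq_intros)
  from field_vector_diff_chain_within[OF this
      has_field_derivative_at_within[OF mat_exp_component_derivative]]
  show "((\<lambda>t. schrodinger_evol H t \<psi> $ i) has_vector_derivative
      (- (\<i> *s (H *v schrodinger_evol H t \<psi>))) $ i) (at t within S)"
    by (simp add: schrodinger_evol_def o_def)
qed

lemma schrodinger_evol_0: "schrodinger_evol H 0 \<psi> = \<psi>"
proof -
  have "(mat_exp (mat_cscale 0 H) *v \<psi>) $ i = \<psi> $ i" for i
    using sums_unique2[OF mat_exp_component_sums[of H \<psi> i 0] powser_sums_zero] by simp
  then show ?thesis by (simp add: schrodinger_evol_def vec_eq_iff)
qed

lemma reduction_error_bound:
  fixes H :: "complex ^ 'n ^ 'n" and V :: "complex ^ 'm ^ 'n"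
  assumes "hermitian H" and sol: "solves_reduced_ivp T H V \<Psi>0 \<Psi>m" and t: "t \<in> {0..T}"
  shows "norm (schrodinger_evol H t \<Psi>0 - \<Psi>m t) \<le> reduction_bound H V \<Psi>0 \<Psi>m t"
proof -
  define P where "P = range_proj V"
  define e where "e s = schrodinger_evol H s \<Psi>0 - \<Psi>m s" for s
  define r where "r s = ((mat 1 - P) ** H) *v \<Psi>m s" for s
  let ?e' = "\<lambda>s. - (\<i> *s (H *v e s)) - \<i> *s r s"
  \<comment> \<open>In this form, adding and subtracting \<open>H *v \<Psi>m s\<close> in the
    derivative of \<open>e\<close> produces \<open>H *v e s\<close> and \<open>r s\<close>.\<close>
  have r: "r s = H *v \<Psi>m s - (P ** H) *v \<Psi>m s" for s
    by (simp add: r_def matrix_vector_mult_diff_rdistrib flip: matrix_vector_mul_assoc)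
  have \<Psi>m: "(\<Psi>m has_vector_derivative - (\<i> *s ((P ** H) *v \<Psi>m s))) (at s within {0..T})"
    if s: "s \<in> {0..T}" for s
  proof -
    obtain D where D: "(\<Psi>m has_vector_derivative D) (at s within {0..T})"
      "\<i> *s D = (P ** H) *v \<Psi>m s"
      using sol s unfolding solves_reduced_ivp_def P_def by blast
    have "- (\<i> *s (\<i> *s D)) = D"
      by (simp add: vec_eq_iff)
    with D show ?thesis by simp
  qed
  have "continuous_on {0..T} \<Psi>m"
    using \<Psi>m has_vector_derivative_continuous continuous_on_eq_continuous_within by blast
  then have cont: "continuous_on {0..t} \<Psi>m"
    using t by (auto intro: continuous_on_subset)
  have "norm (e t) \<le> norm (e 0) + integral {0..t} (\<lambda>s. norm (r s))"
  proof (rule norm_le_of_inner_derivative_le[where e' = ?e'])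
    fix s assume s: "s \<in> {0..t}"
    have "(\<Psi>m has_vector_derivative - (\<i> *s ((P ** H) *v \<Psi>m s))) (at s within {0..t})"
      using has_vector_derivative_within_subset[OF \<Psi>m] s t by auto
    then have "(e has_vector_derivative - (\<i> *s (H *v schrodinger_evol H s \<Psi>0))
        - - (\<i> *s ((P ** H) *v \<Psi>m s))) (at s within {0..t})"
      unfolding e_def
      by (intro has_vector_derivative_diff schrodinger_evol_has_vector_derivative)
    then show "(e has_vector_derivative ?e' s) (at s within {0..t})"
      by (simp add: r e_def matrix_vector_mult_diff_distrib vector_ssub_ldistrib)
    have "e s \<bullet> ?e' s = - (e s \<bullet> (\<i> *s r s))"
      by (simp add: inner_diff_right hermitian_i_inner_eq_0[OF \<open>hermitian H\<close>])
    \<comment> \<open>Cauchy-Schwarz is applied to \<open>- e s\<close> because of the minus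
      sign.\<close>
    also have "\<dots> \<le> norm (e s) * norm (\<i> *s r s)"
      using norm_cauchy_schwarz[of "- e s" "\<i> *s r s"] by simp
    finally show "e s \<bullet> ?e' s \<le> norm (r s) * norm (e s)"
      by (simp add: norm_i_scale mult.commute)
  next
    show "(\<lambda>s. norm (r s)) integrable_on {0..t}"
      unfolding r_def
      by (intro integrable_continuous_real continuous_on_norm cont
          linear_continuous_on_compose[OF cont] linearI)
        (simp_all add: matrix_vector_mult_def vec_eq_iff scaleR_sum_right sum.distrib algebra_simps)
  qed (use t in auto)
  moreover have "e 0 = (mat 1 - P) *v \<Psi>0"
    using sol by (simp add: e_def solves_reduced_ivp_def schrodinger_evol_0 P_def
        matrix_vector_mult_diff_rdistrib)
  ultimately show ?thesis
    by (simp add: e_def reduction_bound_def residual_def[abs_def] r_def P_def)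
qed

theorem theorem2:
  fixes T :: real
    and H :: "complex ^ 'n ^ 'n"
    and \<Psi>0 :: "complex ^ 'n"
    and \<Psi> :: "real \<Rightarrow> complex ^ 'n"
    and V :: "complex ^ 'm ^ 'n"
    and \<Psi>m :: "real \<Rightarrow> complex ^ 'n"
  assumes "T > 0"
    and "hermitian H"
    and "\<And>t. \<Psi> t = schrodinger_evol H t \<Psi>0"
    and "full_column_rank V"
    and "solves_reduced_ivp T H V \<Psi>0 \<Psi>m"
  shows "(\<forall>t\<in>{0..T}. norm (\<Psi> t - \<Psi>m t) \<le> reduction_bound H V \<Psi>0 \<Psi>m t) \<and>
    (\<forall>(A :: complex ^ 'k ^ 'k) u0 u \<epsilon> J R.
      lift_recovery_realization T A u0 u \<epsilon> H J R \<and> \<Psi>0 = J u0 \<longrightarrow>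
      (\<forall>t\<in>{0..T}. norm (u t - R (\<Psi>m t)) \<le> \<epsilon> t + onorm R * reduction_bound H V \<Psi>0 \<Psi>m t))"
proof (intro conjI allI impI ballI)
  show bound: "norm (\<Psi> t - \<Psi>m t) \<le> reduction_bound H V \<Psi>0 \<Psi>m t" if "t \<in> {0..T}" for t
    using reduction_error_bound[OF assms(2,5) that] assms(3) by simp
  fix A :: "complex ^ 'k ^ 'k" and u0 u \<epsilon> J R t
  assume "lift_recovery_realization T A u0 u \<epsilon> H J R \<and> \<Psi>0 = J u0" and t: "t \<in> {0..T}"
  then have R: "Vector_Spaces.linear (*s) (*s) R" and err: "norm (u t - R (\<Psi> t)) \<le> \<epsilon> t"
    using assms(3) by (auto simp: lift_recovery_realization_def)
  interpret R: Vector_Spaces.linear "(*s)" "(*s)" R by (rule R)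
  \<comment> \<open>Complex linearity is restricted to real scalars, since
    \<open>bounded_linear\<close> and \<open>onorm\<close> refer to real linear maps.\<close>
  have "R (c *\<^sub>R x) = c *\<^sub>R R x" for c x
    using R.scale[of "complex_of_real c" x]
    by (simp add: vec_eq_iff scaleR_vec_def vector_scalar_mult_def scaleR_conv_of_real)
  then have "bounded_linear R"
    by (intro linear_conv_bounded_linear[THEN iffD1] linearI R.add)
  then have "norm (R (\<Psi> t - \<Psi>m t)) \<le> onorm R * norm (\<Psi> t - \<Psi>m t)" and "0 \<le> onorm R"
    by (auto intro: onorm onorm_pos_le)
  then have "norm (R (\<Psi> t - \<Psi>m t)) \<le> onorm R * reduction_bound H V \<Psi>0 \<Psi>m t"
    using mult_left_mono[OF bound[OF t], of "onorm R"] by linarith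
  \<comment> \<open>Inserting \<open>R (\<Psi> t)\<close> separates the lifting error from the
    recovered reduction error.\<close>
  moreover have "norm (u t - R (\<Psi>m t)) \<le> norm (u t - R (\<Psi> t)) + norm (R (\<Psi> t - \<Psi>m t))"
    using norm_triangle_ineq[of "u t - R (\<Psi> t)" "R (\<Psi> t - \<Psi>m t)"] by (simp add: R.diff)
  ultimately show "norm (u t - R (\<Psi>m t)) \<le> \<epsilon> t + onorm R * reduction_bound H V \<Psi>0 \<Psi>m t"
    using err by linarith
qed

end
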